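(* Let $n\geq 2$ and let $\mathbb L_n:=\Lambda_n(L_n)\subset\mathbb C^n$ (notation in the context). Then $\mathbb L_n$ cannot be exhausted by domains biholomorphic to convex domains; that is, there is no increasing sequence of domains $D_1\subset D_2\subset\cdots$ with $\bigcup_k D_k=\mathbb L_n$ such that each $D_k$ is biholomorphic to a convex domain.
   Context: For $z\in\mathbb C^n$ put $\|z\|:=\big(\sum_{j=1}^n|z_j|^2\big)^{1/2}$ and $z\bullet z:=\sum_{j=1}^n z_j^2$. The Lie ball (classical Cartan domain of type IV) is $L_n:=\{z\in\mathbb C^n:\ \|z\|<1,\ \sqrt{\|z\|^4-|z\bullet z|^2}<1-\|z\|^2\}$. The map $\Lambda_n:L_n\to\mathbb C^n$ is $\Lambda_n(z_1,\dots,z_n)=(z_1^2,z_2,\dots,z_n)$; it is a proper holomorphic map of multiplicity $2$ onto the domain $\mathbb L_n:=\Lambda_n(L_n)$. *)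

theory Defs
  imports "HOL-Analysis.Analysis"
begin

definition cdot :: "complex^'n \<Rightarrow> complex" where
  "cdot z = (\<Sum>j\<in>UNIV. (z$j)^2)"

definition lie_ball :: "(complex^'n) set" where
  "lie_ball = {z. norm z < 1 \<and>
      sqrt ((norm z)^4 - (cmod (cdot z))^2) < 1 - (norm z)^2}"

text \<open>Lambda_n squares the distinguished coordinate i0 (the paper's z_1) and fixes the others.\<close>
definition Lambda_map :: "'n \<Rightarrow> complex^'n \<Rightarrow> complex^'n" where
  "Lambda_map i0 z = (\<chi> j. if j = i0 then (z$j)^2 else z$j)"

definition holomorphic_n :: "(complex^'n \<Rightarrow> complex^'m) \<Rightarrow> (complex^'n) set \<Rightarrow> bool" where
  "holomorphic_n f U \<longleftrightarrow> (\<forall>z\<in>U. \<exists>f'. (f has_derivative f') (at z) \<and>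
       (\<forall>(c::complex) v. f' (c *s v) = c *s f' v))"

definition is_domain :: "(complex^'n) set \<Rightarrow> bool" where
  "is_domain D \<longleftrightarrow> open D \<and> connected D \<and> D \<noteq> {}"

definition biholomorphic :: "(complex^'n) set \<Rightarrow> (complex^'n) set \<Rightarrow> bool" where
  "biholomorphic D G \<longleftrightarrow> (\<exists>f g. holomorphic_n f D \<and> holomorphic_n g G \<and>
       f ` D = G \<and> (\<forall>z\<in>D. g (f z) = z) \<and> (\<forall>w\<in>G. f (g w) = w))"

end

theory Submission
  imports Defs "HOL-Complex_Analysis.Complex_Singularities"
begin

text \<open>
  Write $(w, t)$ for the $z_1$-coordinate and one further coordinate of a point. The image
  domain is invariant under the weighted dilations $c \cdot (w, t) = (c^2 w, c t)$, $|c| \le 1$.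
  If $f$ maps a domain $D_k$ onto a convex domain, with inverse $g$, then for $x, y$ in the
  image domain (and $k$ large) the disc
  $\psi(c) = c^{-1} \cdot g\bigl(\frac12 (f(c \cdot x) + f(c \cdot y))\bigr)$ has its boundary in
  the image domain. A second-order expansion at $c = 0$ gives
  $\psi(0) = (\frac12 (w_x + w_y) + \frac{b}{4} (t_x - t_y)^2, \frac12 (t_x + t_y))$, where $b$ depends only
  on the second-order behaviour of $f$ at $0$. Every $u$ in the image domain satisfies
  $|w + t^2 - t| \le |1 - t|$, so by the maximum principle $\psi(0)$ does too. The pair
  $(0, r)$, $(-r^2, 0)$ then bounds $\mathrm{Re}\, b$ from below and the pair $(0, r \zeta)$,
  $(0, r \bar\zeta)$ bounds it from above, with $r = 9/10$ and $\zeta = (4 + 3i)/5$; the two bounds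
  are incompatible.
\<close>

subsection \<open>Holomorphic maps between complex coordinate spaces\<close>

lemma norm_smult_cart: "norm (c *s (v :: complex^'n)) = cmod c * norm v"
  by (simp add: norm_vec_def L2_set_right_distrib norm_mult)

lemma norm_le_card_sup_cart:
  fixes v :: "complex^'n"
  assumes "\<And>j. cmod (v $ j) \<le> K"
  shows "norm v \<le> real CARD('n) * K"
proof -
  have "norm v \<le> (\<Sum>j\<in>UNIV. norm (v $ j))"
    unfolding norm_vec_def by (rule L2_set_le_sum) auto
  also have "\<dots> \<le> (\<Sum>j\<in>(UNIV::'n set). K)"
    by (rule sum_mono) (use assms in auto)
  finally show ?thesis by simp
qed

lemma tendsto_smult_cart [tendsto_intros]:
  fixes g :: "'a \<Rightarrow> complex^'n"
  assumes "(f \<longlongrightarrow> a) F" "(g \<longlongrightarrow> b) F"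
  shows "((\<lambda>x. f x *s g x) \<longlongrightarrow> a *s b) F"
  by (rule vec_tendstoI) (auto intro!: tendsto_intros assms)

lemma bounded_linear_smult_left_cart: "bounded_linear (\<lambda>c. c *s (v :: complex^'n))"
  unfolding linear_conv_bounded_linear[symmetric]
  by (rule linearI) (simp_all add: vec_eq_iff algebra_simps)

lemma has_derivative_smult_left_cart:
  assumes "(c has_field_derivative c') (at z)"
  shows "((\<lambda>z. c z *s (v :: complex^'n)) has_derivative (\<lambda>h. h *s (c' *s v))) (at z)"
proof -
  have "(c has_derivative (\<lambda>h. c' * h)) (at z)"
    using assms by (simp add: has_field_derivative_def)
  from bounded_linear.has_derivative[OF bounded_linear_smult_left_cart this]
  show ?thesis by (simp add: vector_smult_assoc mult.commute)
qed

lemma has_derivative_cart_curve: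
  fixes \<gamma> :: "complex \<Rightarrow> complex^'n"
  assumes "\<And>j. ((\<lambda>z. \<gamma> z $ j) has_field_derivative v $ j) (at z)"
  shows "(\<gamma> has_derivative (\<lambda>h. h *s v)) (at z)"
proof -
  have expand: "x = (\<Sum>j\<in>UNIV. (x $ j) *s axis j 1)" for x :: "complex^'n"
    by (simp add: vec_eq_iff axis_def if_distrib cong: if_cong)
  have "((\<lambda>z. \<Sum>j\<in>UNIV. (\<gamma> z $ j) *s axis j 1) has_derivative
      (\<lambda>h. \<Sum>j\<in>UNIV. h *s ((v $ j) *s axis j 1))) (at z)"
    by (intro has_derivative_sum has_derivative_smult_left_cart assms)
  moreover have "(\<lambda>h. \<Sum>j\<in>UNIV. h *s ((v $ j) *s axis j 1)) = (\<lambda>h. h *s v)"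
    by (subst (2) expand) (simp add: vec_eq_iff sum_distrib_left)
  ultimately show ?thesis using expand[of "\<gamma> _"] by simp
qed

text \<open>Complex linearity of the derivative turns the real chain rule into a complex one. This
  lets one-variable theorems act on several-variable maps along lines and discs.\<close>

lemma holomorphic_n_comp_curve:
  fixes f :: "complex^'n \<Rightarrow> complex^'m"
  assumes f: "holomorphic_n f U" and X: "open X"
    and \<gamma>: "\<And>j. (\<lambda>z. \<gamma> z $ j) holomorphic_on X" and U: "\<And>z. z \<in> X \<Longrightarrow> \<gamma> z \<in> U"
  shows "(\<lambda>z. f (\<gamma> z) $ j) holomorphic_on X"
  unfolding holomorphic_on_open[OF X]
proof
  fix z assume z: "z \<in> X"
  define v where "v = (\<chi> j. deriv (\<lambda>z. \<gamma> z $ j) z)"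
  have d\<gamma>: "(\<gamma> has_derivative (\<lambda>h. h *s v)) (at z)"
    by (rule has_derivative_cart_curve)
       (use holomorphic_derivI[OF \<gamma> X z] in \<open>simp add: v_def\<close>)
  obtain f' where f': "(f has_derivative f') (at (\<gamma> z))" "\<And>c v. f' (c *s v) = c *s f' v"
    using f U[OF z] unfolding holomorphic_n_def by blast
  have "((\<lambda>z. f (\<gamma> z)) has_derivative (\<lambda>h. f' (h *s v))) (at z)"
    using has_derivative_compose[OF d\<gamma> f'(1)] .
  from bounded_linear.has_derivative[OF bounded_linear_vec_nth this]
  have "((\<lambda>z. f (\<gamma> z) $ j) has_derivative (\<lambda>h. (f' v $ j) * h)) (at z)"
    by (simp add: f'(2) mult.commute)
  then show "\<exists>f'. ((\<lambda>z. f (\<gamma> z) $ j) has_field_derivative f') (at z)"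
    unfolding has_field_derivative_def by blast
qed

section \<open>Schwarz-type estimates and strict differentiability\<close>

lemma Schwarz_bound:
  fixes \<phi> :: "complex \<Rightarrow> complex"
  assumes hol: "\<phi> holomorphic_on ball 0 r" and r: "r > 0" and 0: "\<phi> 0 = 0"
    and M: "\<And>z. z \<in> ball 0 r \<Longrightarrow> cmod (\<phi> z) < M" and z: "cmod z < r"
  shows "cmod (\<phi> z) \<le> M / r * cmod z"
proof -
  have Mpos: "M > 0" using M[of 0] r 0 by simp
  define h where "h = (\<lambda>w. \<phi> (of_real r * w) / of_real M)"
  have "h holomorphic_on ball 0 1"
    unfolding h_def
    by (intro holomorphic_intros holomorphic_on_compose_gen[OF _ hol, unfolded o_def])
       (use r Mpos in \<open>auto simp: norm_mult\<close>)
  moreover have "h 0 = 0" by (simp add: h_def 0)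
  moreover have "cmod (h w) < 1" if "cmod w < 1" for w
    using M[of "of_real r * w"] that r Mpos by (simp add: h_def norm_mult norm_divide)
  ultimately have "cmod (h (z / of_real r)) \<le> cmod (z / of_real r)"
    using Schwarz_Lemma(1)[of h "z / of_real r"] z r by (simp add: norm_divide)
  then show ?thesis using r Mpos by (simp add: h_def norm_divide field_simps)
qed

text \<open>On the complex line through \<open>a\<close> and \<open>b\<close>, each component of
  \<open>f x - f b\<close> vanishes at \<open>b\<close> and has modulus below \<open>2 * M\<close>
  on a disc of radius \<open>2 * r\<close>, so \<open>Schwarz_bound\<close> applies. The factor 3
  leaves room for that disc around any point of \<open>ball p r\<close>; the factor
  \<open>CARD('m)\<close> passes from components to the norm.\<close>

lemma holomorphic_n_lipschitz:
  fixes f :: "complex^'n \<Rightarrow> complex^'m"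
  assumes f: "holomorphic_n f (ball p (3 * r))" and r: "r > 0"
    and M: "\<And>x. x \<in> ball p (3 * r) \<Longrightarrow> norm (f x) < M"
    and a: "a \<in> ball p r" and b: "b \<in> ball p r"
  shows "norm (f a - f b) \<le> real CARD('m) * (M / r) * norm (a - b)"
proof (cases "a = b")
  case False
  define d where "d = norm (a - b)"
  have d: "0 < d" "d < 2 * r"
    using False a b dist_triangle2[of a b p] by (auto simp: d_def dist_norm norm_minus_commute dist_commute)
  define u where "u = (1 / complex_of_real d) *s (a - b)"
  have u: "norm u = 1"
    unfolding u_def norm_smult_cart using d by (simp add: norm_divide flip: d_def)
  have "b + complex_of_real d *s u = a"
    unfolding u_def vector_smult_assoc using d by simp
  have inb: "b + \<eta> *s u \<in> ball p (3 * r)" if "cmod \<eta> < 2 * r" for \<eta>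
  proof -
    have "dist p (b + \<eta> *s u) \<le> dist p b + norm (\<eta> *s u)"
      by (metis add_diff_cancel_left' dist_norm dist_triangle norm_minus_commute)
    then show ?thesis using that b u by (simp add: norm_smult_cart)
  qed
  have "cmod ((f a - f b) $ j) \<le> M / r * d" for j
  proof -
    define \<phi> where "\<phi> = (\<lambda>\<eta>. f (b + \<eta> *s u) $ j - f b $ j)"
    have "\<phi> holomorphic_on ball 0 (2 * r)"
      unfolding \<phi>_def
      by (intro holomorphic_intros holomorphic_n_comp_curve[OF f])
         (use inb in \<open>auto intro!: holomorphic_intros\<close>)
    moreover have "cmod (\<phi> \<eta>) < 2 * M" if "\<eta> \<in> ball 0 (2 * r)" for \<eta>
    proof -
      have "cmod (f (b + \<eta> *s u) $ j) < M" "cmod (f b $ j) < M"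
        using that M[OF inb[of \<eta>]] M[of b] b r
        by (auto intro: le_less_trans[OF Finite_Cartesian_Product.norm_nth_le])
      then show ?thesis unfolding \<phi>_def using norm_triangle_ineq4[of "f (b + \<eta> *s u) $ j" "f b $ j"] by linarith
    qed
    ultimately have "cmod (\<phi> (of_real d)) \<le> 2 * M / (2 * r) * cmod (of_real d)"
      using r d by (intro Schwarz_bound) (auto simp: \<phi>_def)
    then show ?thesis using d \<open>b + complex_of_real d *s u = a\<close> by (simp add: \<phi>_def)
  qed
  from norm_le_card_sup_cart[OF this] show ?thesis by (simp add: d_def mult.assoc)
qed simp

text \<open>The remainder of the linear approximation at \<open>p\<close> is itself holomorphic and
  small compared with \<open>r\<close> on \<open>ball p (3 * r)\<close>, so
  \<open>holomorphic_n_lipschitz\<close> gives it a small Lipschitz constant. Thus both points may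
  move.\<close>

lemma holomorphic_n_strict_derivative:
  fixes f :: "complex^'n \<Rightarrow> complex^'m"
  assumes f: "holomorphic_n f U" and U: "open U" "p \<in> U"
    and A: "(f has_derivative A) (at p)" "\<And>c v. A (c *s v) = c *s A v" and e: "e > 0"
  shows "\<exists>\<delta>>0. \<forall>a\<in>ball p \<delta>. \<forall>b\<in>ball p \<delta>. norm (f a - f b - A (a - b)) \<le> e * norm (a - b)"
proof -
  interpret A: bounded_linear A using A(1) by (rule has_derivative_bounded_linear)
  \<comment> \<open>The remainder will be strictly below \<open>6 * e' * r\<close>, which makes the
    Lipschitz constant \<open>CARD('m) * 6 * e' = e\<close>.\<close>
  define e' where "e' = e / (6 * real CARD('m))"
  have e': "e' > 0" using e by (simp add: e'_def)
  obtain d where d: "d > 0" "\<And>y. norm (y - p) < d \<Longrightarrow> norm (f y - f p - A (y - p)) \<le> e' * norm (y - p)"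
    using A(1) e' unfolding has_derivative_at_alt by blast
  obtain d2 where d2: "d2 > 0" "ball p d2 \<subseteq> U" using U open_contains_ball by blast
  define r where "r = min d d2 / 3"
  have r: "r > 0" using d d2 by (simp add: r_def)
  define h where "h = (\<lambda>x. f x - f p - A (x - p))"
  have "holomorphic_n h (ball p (3 * r))"
    unfolding holomorphic_n_def
  proof
    fix z assume "z \<in> ball p (3 * r)"
    then have "z \<in> U" using d2 by (auto simp: r_def)
    then obtain f' where f': "(f has_derivative f') (at z)" "\<And>c v. f' (c *s v) = c *s f' v"
      using f unfolding holomorphic_n_def by blast
    have "(h has_derivative (\<lambda>v. f' v - A v)) (at z)"
      unfolding h_def by (auto intro!: derivative_eq_intros f' A.has_derivative)
    then show "\<exists>f'. (h has_derivative f') (at z) \<and> (\<forall>c v. f' (c *s v) = c *s f' v)"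
      using f'(2) A(2) by (intro exI[of _ "\<lambda>v. f' v - A v"]) (auto simp: vector_ssub_ldistrib)
  qed
  moreover have "norm (h x) < 6 * e' * r" if "x \<in> ball p (3 * r)" for x
  proof -
    have n: "norm (x - p) < 3 * r" using that by (simp add: dist_norm norm_minus_commute)
    then have "norm (h x) \<le> e' * norm (x - p)" using d(2)[of x] by (simp add: h_def r_def)
    also have "\<dots> \<le> e' * (3 * r)" using n e' by simp
    also have "\<dots> < 6 * e' * r" using e' r by simp
    finally show ?thesis .
  qed
  ultimately have "norm (h a - h b) \<le> real CARD('m) * (6 * e' * r / r) * norm (a - b)"
    if "a \<in> ball p r" "b \<in> ball p r" for a b
    using that r by (intro holomorphic_n_lipschitz[of h p r]) auto
  moreover have "h a - h b = f a - f b - A (a - b)" for a b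
    by (simp add: h_def A.diff)
  ultimately show ?thesis using r by (intro exI[of _ r]) (simp add: e'_def)
qed

text \<open>Meant for \<open>c = 1 / z^2\<close> and two points at distance O(z) from
  \<open>p\<close> that differ by O(z^2). Plain differentiability at \<open>p\<close> would leave an
  error o(z), too large after division by \<open>z^2\<close>.\<close>

lemma strict_derivative_tendsto:
  fixes f :: "complex^'n \<Rightarrow> complex^'m"
  assumes f: "holomorphic_n f U" and U: "open U" "p \<in> U"
    and A: "(f has_derivative A) (at p)" "\<And>c v. A (c *s v) = c *s A v"
    and a: "(a \<longlongrightarrow> p) F" and b: "(b \<longlongrightarrow> p) F"
    and v: "((\<lambda>x. c x *s (a x - b x)) \<longlongrightarrow> v) F"
  shows "((\<lambda>x. c x *s (f (a x) - f (b x))) \<longlongrightarrow> A v) F"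
proof -
  interpret A: bounded_linear A using A(1) by (rule has_derivative_bounded_linear)
  define R where "R x = c x *s (f (a x) - f (b x) - A (a x - b x))" for x
  have "(R \<longlongrightarrow> 0) F"
    unfolding tendsto_iff dist_0_norm dist_commute[of _ 0]
  proof safe
    fix e :: real assume e: "e > 0"
    define K where "K = norm v + 1"
    have K: "K > 0" by (simp add: K_def add_nonneg_pos)
    then have "e / (2 * K) > 0" using e by simp
    from holomorphic_n_strict_derivative[OF f U A this] obtain \<delta> where \<delta>: "\<delta> > 0"
      "\<And>a b. a \<in> ball p \<delta> \<Longrightarrow> b \<in> ball p \<delta> \<Longrightarrow> norm (f a - f b - A (a - b)) \<le> e / (2 * K) * norm (a - b)"
      by blast
    have "\<forall>\<^sub>F x in F. norm (c x *s (a x - b x)) < K"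
      using order_tendstoD(2)[OF tendsto_norm[OF v], of K] by (simp add: K_def)
    moreover have "\<forall>\<^sub>F x in F. a x \<in> ball p \<delta>" "\<forall>\<^sub>F x in F. b x \<in> ball p \<delta>"
      using a b \<delta>(1) by (auto simp: tendsto_iff dist_commute)
    ultimately show "\<forall>\<^sub>F x in F. norm (R x) < e"
    proof eventually_elim
      case (elim x)
      have "norm (R x) \<le> cmod (c x) * (e / (2 * K) * norm (a x - b x))"
        unfolding R_def norm_smult_cart by (intro mult_left_mono \<delta>(2) elim) auto
      also have "\<dots> = e / (2 * K) * norm (c x *s (a x - b x))"
        unfolding norm_smult_cart by simp
      also have "\<dots> \<le> e / (2 * K) * K" using elim(1) e K by (intro mult_left_mono) auto
      also have "\<dots> < e" using e K by simp
      finally show ?case .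
    qed
  qed
  then have "((\<lambda>x. R x + A (c x *s (a x - b x))) \<longlongrightarrow> 0 + A v) F"
    by (intro tendsto_add A.tendsto v)
  moreover have "R x + A (c x *s (a x - b x)) = c x *s (f (a x) - f (b x))" for x
    unfolding R_def A(2) by (simp add: vec_eq_iff algebra_simps)
  ultimately show ?thesis by simp
qed

section \<open>Second-order expansions along weighted curves\<close>

lemma holomorphic_second_order:
  fixes \<phi> :: "complex \<Rightarrow> complex"
  assumes "\<phi> holomorphic_on X" "open X" "0 \<in> X" "(\<phi> has_field_derivative d) (at 0)"
  shows "\<exists>q. ((\<lambda>z. (\<phi> z - \<phi> 0 - z * d) / z^2) \<longlongrightarrow> q) (at 0)"
proof -
  \<comment> \<open>The difference quotient, completed by \<open>d\<close> at 0, is holomorphic, and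
    its derivative at 0 is the second-order coefficient.\<close>
  define k where "k = (\<lambda>z. if z = 0 then d else (\<phi> z - \<phi> 0) / (z - 0))"
  have "k holomorphic_on X"
    using pole_lemma_open[OF assms(1,2), of 0] by (simp only: k_def DERIV_imp_deriv[OF assms(4)])
  then obtain q where "(k has_field_derivative q) (at 0)"
    using assms(2,3) by (auto simp: holomorphic_on_open)
  then have "((\<lambda>z. (k z - k 0) / (z - 0)) \<longlongrightarrow> q) (at 0)"
    by (simp add: has_field_derivative_iff)
  moreover have "\<forall>\<^sub>F z in at 0. (k z - k 0) / (z - 0) = (\<phi> z - \<phi> 0 - z * d) / z^2"
    unfolding eventually_at_filter
    by (rule always_eventually) (simp add: k_def power2_eq_square diff_divide_distrib)
  ultimately have "((\<lambda>z. (\<phi> z - \<phi> 0 - z * d) / z^2) \<longlongrightarrow> q) (at 0)"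
    by (rule Lim_transform_eventually)
  then show ?thesis ..
qed

lemma holomorphic_n_second_order_line:
  fixes f :: "complex^'n \<Rightarrow> complex^'m"
  assumes f: "holomorphic_n f U" and U: "open U" "0 \<in> U"
    and A: "(f has_derivative A) (at 0)" "\<And>c v. A (c *s v) = c *s A v"
  shows "\<exists>q. ((\<lambda>z. (1 / z^2) *s (f (z *s e) - f 0 - z *s A e)) \<longlongrightarrow> q) (at 0)"
proof -
  define X where "X = (\<lambda>z. z *s e) -` U"
  have X: "open X" "0 \<in> X"
    using open_vimage[OF U(1) linear_continuous_on[OF bounded_linear_smult_left_cart]] U(2)
    by (simp_all add: X_def)
  have hol: "(\<lambda>z. f (z *s e) $ j) holomorphic_on X" for j
    by (rule holomorphic_n_comp_curve[OF f X(1)]) (simp_all add: X_def holomorphic_on_mult)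
  have der: "((\<lambda>z. f (z *s e) $ j) has_field_derivative (A e $ j)) (at 0)" for j
  proof -
    have "((\<lambda>z. f (z *s e)) has_derivative (\<lambda>h. A (h *s e))) (at 0)"
      by (rule has_derivative_compose[OF bounded_linear.has_derivative[OF
            bounded_linear_smult_left_cart has_derivative_ident]]) (simp add: A(1))
    from bounded_linear.has_derivative[OF bounded_linear_vec_nth this, of j]
    moreover have "A (h *s e) $ j = (A e $ j) * h" for h by (simp add: A(2))
    ultimately have "((\<lambda>z. f (z *s e) $ j) has_derivative (\<lambda>h. (A e $ j) * h)) (at 0)"
      by (simp only:)
    then show ?thesis unfolding has_field_derivative_def .
  qed
  have "\<forall>j. \<exists>q. ((\<lambda>z. (f (z *s e) $ j - f (0 *s e) $ j - z * (A e $ j)) / z^2) \<longlongrightarrow> q) (at 0)"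
    by (intro allI holomorphic_second_order[OF hol X der])
  from choice[OF this] obtain q where "\<And>j. ((\<lambda>z. (f (z *s e) $ j - f (0 *s e) $ j - z * (A e $ j)) / z^2) \<longlongrightarrow> q j) (at 0)"
    by (auto elim!: exE)
  then show ?thesis by (intro exI[of _ "\<chi> j. q j"] vec_tendstoI) (simp add: diff_divide_distrib)
qed

text \<open>Replacing \<open>z\<close> by \<open>z * t\<close> on the line scales its quadratic
  coefficient \<open>q\<close> by \<open>t^2\<close>; the shift \<open>z^2 *s \<omega>\<close> adds
  just \<open>A \<omega>\<close>, by strict differentiability. A single \<open>q\<close> serves all
  \<open>t\<close> and \<open>\<omega>\<close>.\<close>

lemma holomorphic_n_second_order:
  fixes f :: "complex^'n \<Rightarrow> complex^'m"
  assumes f: "holomorphic_n f U" and U: "open U" "0 \<in> U"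
    and A: "(f has_derivative A) (at 0)" "\<And>c v. A (c *s v) = c *s A v"
  shows "\<exists>q. \<forall>t \<omega>. ((\<lambda>z. (1 / z^2) *s (f ((z * t) *s e + z^2 *s \<omega>) - f 0 - (z * t) *s A e))
           \<longlongrightarrow> t^2 *s q + A \<omega>) (at 0)"
proof -
  obtain q where q: "((\<lambda>z. (1 / z^2) *s (f (z *s e) - f 0 - z *s A e)) \<longlongrightarrow> q) (at 0)"
    using holomorphic_n_second_order_line[OF f U A] by blast
  have "((\<lambda>z. (1 / z^2) *s (f ((z * t) *s e + z^2 *s \<omega>) - f 0 - (z * t) *s A e))
           \<longlongrightarrow> t^2 *s q + A \<omega>) (at 0)" for t \<omega>
  proof -
    have 1: "((\<lambda>z. (1 / z^2) *s (f ((z * t) *s e) - f 0 - (z * t) *s A e)) \<longlongrightarrow> t^2 *s q) (at 0)"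
    \<comment> \<open>For \<open>t = 0\<close> the map \<open>z * t\<close> does not avoid 0, so the
      substitution fails, but the expression vanishes identically.\<close>
    proof (cases "t = 0")
      case False
      have "filterlim (\<lambda>z. z * t) (at 0) (at 0)"
        by (rule filterlim_atI) (use False in \<open>auto intro!: tendsto_eq_intros simp: eventually_at_filter\<close>)
      from filterlim_compose[OF q this]
      have "((\<lambda>z. t^2 *s ((1 / (z * t)^2) *s (f ((z * t) *s e) - f 0 - (z * t) *s A e))) \<longlongrightarrow> t^2 *s q) (at 0)"
        by (intro tendsto_intros)
      then show ?thesis
        using False by (simp add: vector_smult_assoc power_mult_distrib)
    qed simp
    have "\<forall>\<^sub>F z::complex in at 0. \<omega> = (1 / z^2) *s (((z * t) *s e + z^2 *s \<omega>) - (z * t) *s e)"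
      unfolding eventually_at_filter by (rule always_eventually) (simp add: vector_smult_assoc)
    then have "((\<lambda>z. (1 / z^2) *s (((z * t) *s e + z^2 *s \<omega>) - (z * t) *s e)) \<longlongrightarrow> \<omega>) (at 0)"
      by (rule Lim_transform_eventually[OF tendsto_const])
    then have 2: "((\<lambda>z. (1 / z^2) *s (f ((z * t) *s e + z^2 *s \<omega>) - f ((z * t) *s e))) \<longlongrightarrow> A \<omega>) (at 0)"
      by (intro strict_derivative_tendsto[OF f U A]) (auto intro!: tendsto_eq_intros)
    show ?thesis using tendsto_add[OF 1 2]
      by (simp add: vector_ssub_ldistrib algebra_simps)
  qed
  then show ?thesis by blast
qed

lemma midpoint_remainder_cart:
  fixes x y p w e :: "complex^'n"
  shows "(1/2) *s (c *s (x - p - (z * s) *s e) + c *s (y - p - (z * t) *s e))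
         - c *s (w - p - (z * ((s + t) / 2)) *s e) = c *s ((1/2) *s (x + y) - w)"
  by (simp add: vec_eq_iff algebra_simps add_divide_distrib)

text \<open>The mean of the two image curves agrees up to o(z^2) with the image of one explicit
  weighted curve; applying \<open>g\<close> keeps this precision. The vector \<open>b\<close> is
  \<open>B q\<close>, with \<open>B\<close> the derivative of \<open>g\<close> at \<open>f 0\<close>
  and \<open>q\<close> the quadratic coefficient of \<open>f\<close> in direction \<open>e\<close>,
  hence common to all pairs of curves.\<close>

lemma midpoint_second_order:
  fixes f :: "complex^'n \<Rightarrow> complex^'m"
  assumes f: "holomorphic_n f D" and g: "holomorphic_n g G" and D: "open D" "0 \<in> D"
    and G: "open G" "f ` D = G"
    and gf: "\<And>z. z \<in> D \<Longrightarrow> g (f z) = z" and fg: "\<And>w. w \<in> G \<Longrightarrow> f (g w) = w"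
  shows "\<exists>b. \<forall>s t \<omega> \<eta>. ((\<lambda>z. (1 / z^2) *s
            (g ((1/2) *s (f ((z * s) *s e + z^2 *s \<omega>) + f ((z * t) *s e + z^2 *s \<eta>))) - (z * ((s + t) / 2)) *s e))
           \<longlongrightarrow> (1/2) *s (\<omega> + \<eta>) + ((s - t)^2 / 4) *s b) (at 0)"
proof -
  obtain A where A: "(f has_derivative A) (at 0)" "\<And>c v. A (c *s v) = c *s A v"
    using f D unfolding holomorphic_n_def by blast
  have f0: "f 0 \<in> G" using D G by blast
  obtain B where B: "(g has_derivative B) (at (f 0))" "\<And>c v. B (c *s v) = c *s B v"
    using g f0 unfolding holomorphic_n_def by blast
  interpret A: bounded_linear A using A(1) by (rule has_derivative_bounded_linear)
  interpret B: bounded_linear B using B(1) by (rule has_derivative_bounded_linear)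
  \<comment> \<open>Differentiating \<open>f (g w) = w\<close> at \<open>f 0\<close>; this will turn
    \<open>A (B q)\<close> back into \<open>q\<close>.\<close>
  have AB: "A (B v) = v" for v
  proof -
    have "((\<lambda>w. f (g w)) has_derivative (\<lambda>v. A (B v))) (at (f 0))"
      using has_derivative_compose[OF B(1), of f A] A(1) gf D by simp
    moreover have "((\<lambda>w. f (g w)) has_derivative (\<lambda>v. v)) (at (f 0))"
      by (rule has_derivative_transform_within_open[OF has_derivative_ident G(1) f0]) (simp add: fg)
    ultimately show ?thesis using has_derivative_unique by metis
  qed
  obtain q where q: "\<And>t \<omega>. ((\<lambda>z. (1 / z^2) *s (f ((z * t) *s e + z^2 *s \<omega>) - f 0 - (z * t) *s A e))
           \<longlongrightarrow> t^2 *s q + A \<omega>) (at 0)"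
    using holomorphic_n_second_order[OF f D A] by blast
  have lim: "((\<lambda>z. (z * t) *s e + z^2 *s \<omega>) \<longlongrightarrow> 0) (at 0)" for t and \<omega> :: "complex^'n"
    by (auto intro!: tendsto_eq_intros)
  have limf: "((\<lambda>z. f ((z * t) *s e + z^2 *s \<omega>)) \<longlongrightarrow> f 0) (at 0)" for t \<omega>
    using isCont_tendsto_compose[OF has_derivative_continuous[OF A(1)] lim] .
  have "((\<lambda>z. (1 / z^2) *s
            (g ((1/2) *s (f ((z * s) *s e + z^2 *s \<omega>) + f ((z * t) *s e + z^2 *s \<eta>))) - (z * ((s + t) / 2)) *s e))
           \<longlongrightarrow> (1/2) *s (\<omega> + \<eta>) + ((s - t)^2 / 4) *s B q) (at 0)" for s t \<omega> \<eta>
  proof -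
    \<comment> \<open>The value of \<open>\<xi>\<close> is forced by matching second-order terms:
      the mean contributes \<open>(s^2 + t^2) / 2\<close> times \<open>q\<close>, the curve
      \<open>\<gamma>\<close> contributes \<open>((s + t) / 2)^2\<close> times \<open>q\<close>, and
      the gap is \<open>(s - t)^2 / 4\<close>.\<close>
    define \<xi> where "\<xi> = (1/2) *s (\<omega> + \<eta>) + ((s - t)^2 / 4) *s B q"
    define \<gamma> where "\<gamma> z = (z * ((s + t) / 2)) *s e + z^2 *s \<xi>" for z
    define m where "m z = (1/2) *s (f ((z * s) *s e + z^2 *s \<omega>) + f ((z * t) *s e + z^2 *s \<eta>))" for z
    have "((\<lambda>z. (1/2) *s ((1 / z^2) *s (f ((z * s) *s e + z^2 *s \<omega>) - f 0 - (z * s) *s A e) +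
              (1 / z^2) *s (f ((z * t) *s e + z^2 *s \<eta>) - f 0 - (z * t) *s A e))
            - (1 / z^2) *s (f (\<gamma> z) - f 0 - (z * ((s + t) / 2)) *s A e))
        \<longlongrightarrow> (1/2) *s ((s^2 *s q + A \<omega>) + (t^2 *s q + A \<eta>)) - (((s + t) / 2)^2 *s q + A \<xi>)) (at 0)"
      unfolding \<gamma>_def by (intro tendsto_intros q)
    moreover have "(1/2) *s ((s^2 *s q + A \<omega>) + (t^2 *s q + A \<eta>)) - (((s + t) / 2)^2 *s q + A \<xi>) = 0"
      unfolding \<xi>_def A.add A(2) AB
      by (simp add: vec_eq_iff power2_eq_square field_simps)
    moreover have "(1/2) *s ((1 / z^2) *s (f ((z * s) *s e + z^2 *s \<omega>) - f 0 - (z * s) *s A e) +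
              (1 / z^2) *s (f ((z * t) *s e + z^2 *s \<eta>) - f 0 - (z * t) *s A e))
            - (1 / z^2) *s (f (\<gamma> z) - f 0 - (z * ((s + t) / 2)) *s A e) =
           (1 / z^2) *s (m z - f (\<gamma> z))" for z
      unfolding m_def by (rule midpoint_remainder_cart)
    ultimately have mf: "((\<lambda>z. (1 / z^2) *s (m z - f (\<gamma> z))) \<longlongrightarrow> 0) (at 0)"
      by (simp only:)
    have "(m \<longlongrightarrow> (1/2) *s (f 0 + f 0)) (at 0)"
      unfolding m_def by (intro tendsto_intros limf)
    moreover have "(1/2) *s (f 0 + f 0) = f 0" by (simp add: vec_eq_iff)
    ultimately have "(m \<longlongrightarrow> f 0) (at 0)" by simp
    from strict_derivative_tendsto[OF g G(1) f0 B this _ mf]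
    have "((\<lambda>z. (1 / z^2) *s (g (m z) - g (f (\<gamma> z)))) \<longlongrightarrow> 0) (at 0)"
      using limf[of "(s + t) / 2" \<xi>] by (simp add: \<gamma>_def B.zero)
    then have "((\<lambda>z. (1 / z^2) *s (g (m z) - g (f (\<gamma> z))) + \<xi>) \<longlongrightarrow> 0 + \<xi>) (at 0)"
      by (intro tendsto_intros)
    moreover have "\<forall>\<^sub>F z in at 0. (1 / z^2) *s (g (m z) - g (f (\<gamma> z))) + \<xi> =
        (1 / z^2) *s (g (m z) - (z * ((s + t) / 2)) *s e)"
    proof -
      have *: "(1 / z^2) *s (x - (w + z^2 *s v)) + v = (1 / z^2) *s (x - w)"
        if "z \<noteq> 0" for z and x w v :: "complex^'n"
        using that by (simp add: vec_eq_iff diff_divide_distrib add_divide_distrib)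
      have "\<forall>\<^sub>F z in at 0. \<gamma> z \<in> D"
        using topological_tendstoD[OF lim D] unfolding \<gamma>_def .
      moreover have "\<forall>\<^sub>F z::complex in at 0. z \<noteq> 0" by (simp add: eventually_at_filter)
      ultimately show ?thesis
        by eventually_elim (simp only: gf, simp only: \<gamma>_def * not_False_eq_True)
    qed
    ultimately have "((\<lambda>z. (1 / z^2) *s (g (m z) - (z * ((s + t) / 2)) *s e)) \<longlongrightarrow> 0 + \<xi>) (at 0)"
      by (rule Lim_transform_eventually)
    then show ?thesis by (simp add: m_def \<xi>_def)
  qed
  then show ?thesis by blast
qed

subsection \<open>The Lie ball and its image\<close>

text \<open>Once \<open>u z / z\<close> and \<open>v z / z^2\<close> are extended over 0 to
  \<open>S\<close> and \<open>V\<close>, the claim says that \<open>(V + S^2 - S) / (1 - S)\<close>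
  has modulus at most 1 at 0. This holds on the unit circle by \<open>bv\<close>, and
  \<open>bu\<close> keeps the denominator away from zero inside.\<close>

lemma maximum_modulus_quotient:
  fixes u v :: "complex \<Rightarrow> complex"
  assumes X: "open X" "cball 0 1 \<subseteq> X" and u: "u holomorphic_on X" and v: "v holomorphic_on X"
    and T: "((\<lambda>z. u z / z) \<longlongrightarrow> T) (at 0)" and W: "((\<lambda>z. v z / z^2) \<longlongrightarrow> W) (at 0)"
    and bu: "\<And>z. cmod z = 1 \<Longrightarrow> cmod (u z / z) < 1"
    and bv: "\<And>z. cmod z = 1 \<Longrightarrow> cmod (v z / z^2 + (u z / z)^2 - u z / z) \<le> cmod (1 - u z / z)"
  shows "cmod (W + T^2 - T) \<le> cmod (1 - T)"
proof -
  define S where "S = (\<lambda>z. if z = 0 then T else u z / z)"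
  define V where "V = (\<lambda>z. if z = 0 then W else v z / z^2)"
  have S: "S holomorphic_on X" and V: "V holomorphic_on X"
    unfolding S_def V_def
    by (rule removable_singularity[OF _ X(1)];
        use T W in \<open>auto intro!: holomorphic_intros intro: holomorphic_on_subset[OF u] holomorphic_on_subset[OF v]\<close>)+
  have max: "cmod (h z) \<le> B"
    if h: "h holomorphic_on cball 0 1" and B: "\<And>z. cmod z = 1 \<Longrightarrow> cmod (h z) \<le> B" and z: "z \<in> cball 0 1"
    for h B z
  proof (rule maximum_modulus_frontier[of h "cball 0 1"])
    show "h holomorphic_on interior (cball 0 1)"
      using h by (rule holomorphic_on_subset) (rule interior_subset)
    show "continuous_on (closure (cball 0 1)) h" using h by (simp add: holomorphic_on_imp_continuous_on)
  qed (use B z in \<open>auto simp: dist_norm\<close>)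
  \<comment> \<open>The maximum on the circle is attained, so the pointwise strict bound there
    becomes a uniform one below 1, which the maximum principle carries into the disc.\<close>
  have "continuous_on (sphere 0 1) (\<lambda>z. cmod (S z))"
    using X(2) by (intro continuous_intros holomorphic_on_imp_continuous_on holomorphic_on_subset[OF S]) auto
  then obtain w where w: "cmod w = 1" "\<And>z. cmod z = 1 \<Longrightarrow> cmod (S z) \<le> cmod (S w)"
    using continuous_attains_sup[of "sphere (0::complex) 1" "\<lambda>z. cmod (S z)"] by auto
  have "cmod (S w) < 1" using bu[OF w(1)] w(1) by (auto simp: S_def)
  then have S1: "S z \<noteq> 1" if "z \<in> cball 0 1" for z
    using max[OF holomorphic_on_subset[OF S X(2)] w(2) that] by auto
  have S0: "1 - S z \<noteq> 0" if "z \<in> cball 0 1" for z using S1[OF that] by simp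
  have "(\<lambda>z. (V z + S z ^ 2 - S z) / (1 - S z)) holomorphic_on cball 0 1"
    by (intro holomorphic_intros holomorphic_on_subset[OF S X(2)] holomorphic_on_subset[OF V X(2)] S0)
  moreover have "cmod ((V z + S z ^ 2 - S z) / (1 - S z)) \<le> 1" if z: "cmod z = 1" for z
  proof -
    have "z \<noteq> 0" using z by auto
    then show ?thesis using bv[OF z] S0[of z] z by (simp add: S_def V_def norm_divide)
  qed
  ultimately have "cmod ((V 0 + S 0 ^ 2 - S 0) / (1 - S 0)) \<le> 1"
    by (rule max) auto
  then show ?thesis using S0[of 0] by (simp add: S_def V_def norm_divide)
qed

text \<open>With \<open>S = p + q\<close> and \<open>P = p * q\<close> this bounds
  \<open>(2 * P - S) / (2 - S)\<close> on the symmetrized bidisc. The difference of squared moduli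
  is smallest, for given moduli \<open>a\<close> and \<open>b\<close>, when \<open>p\<close> and
  \<open>q\<close> are real and nonnegative; there it factors as
  \<open>(1 - a * b) * ((1 - a) * (1 - b))\<close>.\<close>

lemma norm_sum_prod_le:
  fixes p q :: complex
  assumes p: "cmod p < 1" and q: "cmod q < 1"
  shows "cmod (p * q - (p + q) / 2) \<le> cmod (1 - (p + q) / 2)"
proof -
  define a where "a = cmod p" define b where "b = cmod q"
  have ab: "0 \<le> a" "a < 1" "0 \<le> b" "b < 1" using assms by (auto simp: a_def b_def)
  have a2: "a^2 = (Re p)^2 + (Im p)^2" and b2: "b^2 = (Re q)^2 + (Im q)^2"
    by (simp_all add: a_def b_def cmod_power2)
  have id: "(cmod (1 - (p + q) / 2))^2 - (cmod (p * q - (p + q) / 2))^2 =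
      1 - a^2 * b^2 - (1 - a^2) * Re q - (1 - b^2) * Re p"
    unfolding a2 b2 cmod_power2 by (simp add: power2_eq_square field_simps)
  have "(1 - a^2) * Re q \<le> (1 - a^2) * b" "(1 - b^2) * Re p \<le> (1 - b^2) * a"
    using ab complex_Re_le_cmod[of p] complex_Re_le_cmod[of q]
    by (auto intro!: mult_left_mono simp: a_def b_def power_le_one)
  then have "1 - a^2 * b^2 - (1 - a^2) * Re q - (1 - b^2) * Re p \<ge> 1 - a^2 * b^2 - (1 - a^2) * b - (1 - b^2) * a"
    by linarith
  also have "1 - a^2 * b^2 - (1 - a^2) * b - (1 - b^2) * a = (1 - a * b) * ((1 - a) * (1 - b))"
    by (simp add: power2_eq_square algebra_simps)
  also have "\<dots> \<ge> 0"
    using ab mult_mono[of a 1 b 1] by (intro mult_nonneg_nonneg) auto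
  finally have "(cmod (p * q - (p + q) / 2))^2 \<le> (cmod (1 - (p + q) / 2))^2"
    using id by linarith
  then show ?thesis by (rule power2_le_imp_le) simp
qed

text \<open>In dimension 2 these two linear forms identify the Lie ball with the bidisc. In general
  the remaining coordinates contribute \<open>R\<close> to the squared norm and at most
  \<open>R\<close> to \<open>cmod (cdot z)\<close>, so the estimate survives.\<close>

lemma lie_ball_norm_less:
  fixes z :: "complex^'n"
  assumes z: "z \<in> lie_ball" and ij: "i \<noteq> j"
  shows "cmod (z $ j + \<i> * z $ i) < 1" "cmod (z $ j - \<i> * z $ i) < 1"
proof -
  define N where "N = (norm z)^2"
  define c where "c = cmod (cdot z)"
  define R where "R = (\<Sum>k\<in>UNIV - {i, j}. (cmod (z $ k))^2)"
  have zN: "N < 1" "sqrt (N^2 - c^2) < 1 - N"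
    using z by (auto simp: lie_ball_def N_def c_def power_mult[symmetric] power_less_one_iff abs_square_less_1)
  have split: "sum h UNIV = h i + h j + sum h (UNIV - {i, j})" for h :: "'n \<Rightarrow> 'b::ab_group_add"
    using ij by (simp add: sum.remove[of UNIV i] sum.remove[of "UNIV - {i}" j] Diff_insert2[symmetric] insert_commute add.assoc)
  have N: "N = (cmod (z $ i))^2 + (cmod (z $ j))^2 + R"
    unfolding N_def R_def norm_vec_def L2_set_def
    by (subst real_sqrt_pow2) (auto intro!: sum_nonneg add_nonneg_nonneg simp: split)
  have "cmod (\<Sum>k\<in>UNIV - {i, j}. (z $ k)^2) \<le> R"
    unfolding R_def by (rule order_trans[OF norm_sum]) (simp add: norm_power)
  then have c: "c \<le> cmod ((z $ i)^2 + (z $ j)^2) + R"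
    unfolding c_def cdot_def split[of "\<lambda>k. (z $ k)^2"]
    by (intro order_trans[OF norm_triangle_ineq]) auto
  have R: "R \<ge> 0" unfolding R_def by (intro sum_nonneg) auto
  \<comment> \<open>Both hypotheses are symmetric in \<open>p\<close> and \<open>q\<close>, so one
    argument covers both signs.\<close>
  have main: "cmod p < 1" if pq: "p * q = (z $ i)^2 + (z $ j)^2"
      "(cmod p)^2 + (cmod q)^2 = 2 * ((cmod (z $ i))^2 + (cmod (z $ j))^2)" for p q
  proof -
    define a where "a = cmod p" define b where "b = cmod q"
    have "a \<ge> 0" "b \<ge> 0" by (auto simp: a_def b_def)
    have c': "c \<le> a * b + R" using c by (simp add: pq(1)[symmetric] norm_mult a_def b_def)
    have N': "N = (a^2 + b^2) / 2 + R" using N pq(2) by (simp add: a_def b_def)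
    have "c^2 \<le> (a * b + R)^2" using c' by (intro power_mono) (auto simp: c_def)
    moreover have "N^2 - (a * b + R)^2 = ((a^2 - b^2) / 2)^2 + R * (a - b)^2"
      unfolding N' by (simp add: power2_eq_square field_simps)
    ultimately have "((a^2 - b^2) / 2)^2 \<le> N^2 - c^2"
      using mult_nonneg_nonneg[OF R zero_le_power2[of "a - b"]] by linarith
    then have "(a^2 - b^2) / 2 \<le> sqrt (N^2 - c^2)" by (rule real_le_rsqrt)
    then have "a^2 < 1" using zN N' R by (simp add: field_simps)
    then show ?thesis by (simp add: a_def abs_square_less_1)
  qed
  have e1: "(z $ j + \<i> * z $ i) * (z $ j - \<i> * z $ i) = (z $ i)^2 + (z $ j)^2"
    by (simp add: power2_eq_square algebra_simps)
  have e2: "(cmod (z $ j + \<i> * z $ i))^2 + (cmod (z $ j - \<i> * z $ i))^2 = 2 * ((cmod (z $ i))^2 + (cmod (z $ j))^2)"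
    unfolding cmod_power2 by (simp add: power2_eq_square algebra_simps)
  show "cmod (z $ j + \<i> * z $ i) < 1" by (rule main[OF e1 e2])
  show "cmod (z $ j - \<i> * z $ i) < 1" by (rule main[of _ "z $ j + \<i> * z $ i"]) (use e1 e2 in \<open>auto simp: mult.commute add.commute\<close>)
qed

text \<open>For the forms \<open>p\<close>, \<open>q\<close> of \<open>lie_ball_norm_less\<close>,
  \<open>u $ j\<close> is their mean and \<open>u $ i + (u $ j)^2\<close> is their product, so
  \<open>norm_sum_prod_le\<close> is the second bound.\<close>

lemma Lambda_lie_ball_bounds:
  fixes u :: "complex^'n"
  assumes u: "u \<in> Lambda_map i ` lie_ball" and ij: "i \<noteq> j"
  shows "cmod (u $ j) < 1" "cmod (u $ i + (u $ j)^2 - u $ j) \<le> cmod (1 - u $ j)"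
proof -
  obtain z where z: "z \<in> lie_ball" and u: "u = Lambda_map i z" using u by blast
  have ui: "u $ i = (z $ i)^2" and uj: "u $ j = z $ j"
    using ij by (auto simp: u Lambda_map_def)
  define p where "p = z $ j + \<i> * z $ i" define q where "q = z $ j - \<i> * z $ i"
  have pq: "cmod p < 1" "cmod q < 1" using lie_ball_norm_less[OF z ij] by (auto simp: p_def q_def)
  have s: "(p + q) / 2 = z $ j" and m: "p * q = (z $ i)^2 + (z $ j)^2"
    by (auto simp: p_def q_def power2_eq_square algebra_simps)
  show "cmod (u $ j) < 1"
    using norm_triangle_ineq[of p q] pq unfolding uj s[symmetric] by (simp add: norm_divide)
  show "cmod (u $ i + (u $ j)^2 - u $ j) \<le> cmod (1 - u $ j)"
    using norm_sum_prod_le[OF pq] unfolding s m ui uj .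
qed

section \<open>Dilations and test points of the Lie ball\<close>

lemma lie_ball_balanced:
  assumes "z \<in> lie_ball" "cmod c \<le> 1"
  shows "c *s z \<in> lie_ball"
proof -
  define N where "N = norm z"
  define r where "r = cmod c"
  have r: "0 \<le> r" "r \<le> 1" using assms by (auto simp: r_def)
  have N: "0 \<le> N" "N < 1" "sqrt (N^4 - (cmod (cdot z))^2) < 1 - N^2"
    using assms by (auto simp: lie_ball_def N_def)
  have cd: "cdot (c *s z) = c^2 * cdot z"
    by (simp add: cdot_def sum_distrib_left power_mult_distrib)
  have "(r * N)^4 - (r^2 * cmod (cdot z))^2 = (r^2)^2 * (N^4 - (cmod (cdot z))^2)"
    by (simp add: power_mult_distrib algebra_simps flip: power_mult)
  then have "sqrt ((r * N)^4 - (r^2 * cmod (cdot z))^2) = r^2 * sqrt (N^4 - (cmod (cdot z))^2)"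
    unfolding real_sqrt_mult by (simp only: real_sqrt_mult real_sqrt_abs abs_power2)
  also have "\<dots> \<le> r^2 * (1 - N^2)" using N by (intro mult_left_mono) auto
  also have "\<dots> = r^2 - (r * N)^2" by (simp add: power_mult_distrib algebra_simps)
  finally have s: "sqrt ((r * N)^4 - (r^2 * cmod (cdot z))^2) \<le> r^2 - (r * N)^2" .
  have rN: "r * N < 1" using mult_right_mono[OF r(2) N(1)] N by linarith
  have "sqrt ((r * N)^4 - (r^2 * cmod (cdot z))^2) < 1 - (r * N)^2"
  \<comment> \<open>The scaled estimate \<open>s\<close> is not strict. For \<open>r < 1\<close>
    strictness comes from \<open>r^2 < 1\<close>; for \<open>r = 1\<close> it is the original
    inequality.\<close>
  proof (cases "r = 1")
    case False
    then have "r^2 < 1" using r by (simp add: abs_square_less_1)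
    then show ?thesis using s by linarith
  qed (use N in simp)
  then show ?thesis using rN
    by (simp add: lie_ball_def norm_smult_cart cd norm_mult norm_power flip: r_def N_def)
qed

lemma axis_in_lie_ball:
  assumes "cmod c < 1"
  shows "axis k c \<in> lie_ball"
proof -
  have "norm (axis k c) = cmod c"
    by (simp add: norm_vec_def L2_set_def axis_def if_distrib[of "\<lambda>x. (norm x)^2"] cong: if_cong)
  moreover have "cdot (axis k c) = c^2"
    by (simp add: cdot_def axis_def if_distrib[of "\<lambda>x. x^2"] cong: if_cong)
  ultimately show ?thesis using assms
    by (simp add: lie_ball_def norm_power abs_square_less_1 flip: power_mult)
qed

lemma Lambda_map_smult: "Lambda_map i (c *s z) = (\<chi> j. (if j = i then c^2 else c) * Lambda_map i z $ j)"
  by (simp add: vec_eq_iff Lambda_map_def power_mult_distrib)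

subsection \<open>Convex models\<close>

text \<open>The orbit of the point with coordinates \<open>w\<close> at \<open>i\<close> and
  \<open>t\<close> at \<open>j\<close> under the weighted dilations, written as a line plus a
  quadratic shift to fit the curves in \<open>midpoint_second_order\<close>.\<close>

definition quasi_disc :: "'n \<Rightarrow> 'n \<Rightarrow> complex \<Rightarrow> complex \<Rightarrow> complex \<Rightarrow> complex^'n" where
  "quasi_disc i j w t c = (c * t) *s axis j 1 + c^2 *s axis i w"

lemma quasi_disc_Lambda_axis:
  assumes "i \<noteq> j"
  shows "quasi_disc i j 0 t c = Lambda_map i (c *s axis j t)"
    and "quasi_disc i j (w^2) 0 c = Lambda_map i (c *s axis i w)"
  using assms by (auto simp: quasi_disc_def Lambda_map_def vec_eq_iff axis_def power_mult_distrib)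

lemma continuous_on_quasi_disc: "continuous_on S (quasi_disc i j w t)"
  unfolding quasi_disc_def continuous_on_def by (auto intro!: tendsto_intros)

lemma holomorphic_on_quasi_disc: "(\<lambda>c. quasi_disc i j w t c $ k) holomorphic_on S"
  unfolding quasi_disc_def by (auto intro!: holomorphic_intros)

lemma open_vimage_quasi_disc: "open D \<Longrightarrow> open (quasi_disc i j w t -` D)"
  by (rule open_vimage[OF _ continuous_on_quasi_disc])

text \<open>Convexity keeps the midpoint of the two image discs in \<open>G\<close>, so
  \<open>g\<close> pulls it back to a disc \<open>\<psi>\<close> in \<open>D\<close>. Undoing the
  dilation gives boundary values satisfying \<open>Lambda_lie_ball_bounds\<close>, and
  \<open>maximum_modulus_quotient\<close> transfers the bound to the centre, computed by
  \<open>midpoint_second_order\<close>. What matters is that \<open>b\<close> is chosen before the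
  two discs.\<close>

lemma convex_model_inequality:
  fixes D :: "(complex^'n) set"
  assumes D: "open D" "0 \<in> D" "D \<subseteq> Lambda_map i ` lie_ball" and ij: "i \<noteq> j"
    and G: "open G" "convex G" and DG: "biholomorphic D G"
  shows "\<exists>b. \<forall>w s w' t. quasi_disc i j w s ` cball 0 1 \<subseteq> D \<longrightarrow> quasi_disc i j w' t ` cball 0 1 \<subseteq> D \<longrightarrow>
           cmod ((w + w') / 2 + (s - t)^2 / 4 * b + ((s + t) / 2)^2 - (s + t) / 2) \<le> cmod (1 - (s + t) / 2)"
proof -
  obtain f g where f: "holomorphic_n f D" and g: "holomorphic_n g G" and fD: "f ` D = G"
    and gf: "\<And>z. z \<in> D \<Longrightarrow> g (f z) = z" and fg: "\<And>w. w \<in> G \<Longrightarrow> f (g w) = w"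
    using DG unfolding biholomorphic_def by blast
  have gG: "g w \<in> D" if "w \<in> G" for w using that fD gf by auto
  obtain b where b: "\<And>s t \<omega> \<eta>. ((\<lambda>z. (1 / z^2) *s
            (g ((1/2) *s (f ((z * s) *s axis j 1 + z^2 *s \<omega>) + f ((z * t) *s axis j 1 + z^2 *s \<eta>)))
             - (z * ((s + t) / 2)) *s axis j 1))
           \<longlongrightarrow> (1/2) *s (\<omega> + \<eta>) + ((s - t)^2 / 4) *s b) (at 0)"
    using midpoint_second_order[OF f g D(1,2) G(1) fD gf fg, of "axis j 1"] by blast
  have "cmod ((w + w') / 2 + (s - t)^2 / 4 * (b $ i) + ((s + t) / 2)^2 - (s + t) / 2) \<le> cmod (1 - (s + t) / 2)"
    if w: "quasi_disc i j w s ` cball 0 1 \<subseteq> D" and w': "quasi_disc i j w' t ` cball 0 1 \<subseteq> D" for w s w' t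
  proof -
    define X where "X = quasi_disc i j w s -` D \<inter> quasi_disc i j w' t -` D"
    define m where "m z = (1/2) *s (f (quasi_disc i j w s z) + f (quasi_disc i j w' t z))" for z
    define \<psi> where "\<psi> z = g (m z)" for z
    have X: "open X" "cball 0 1 \<subseteq> X"
      using w w' D(1) by (auto simp: X_def intro!: open_Int open_vimage_quasi_disc)
    have mG: "m z \<in> G" if "z \<in> X" for z
    proof -
      have "f (quasi_disc i j w s z) \<in> G" "f (quasi_disc i j w' t z) \<in> G"
        using that fD by (auto simp: X_def)
      from convexD[OF G(2) this, of "1/2" "1/2"]
      have "(1/2) *\<^sub>R f (quasi_disc i j w s z) + (1/2) *\<^sub>R f (quasi_disc i j w' t z) \<in> G" by simp
      moreover have "(1/2) *\<^sub>R x + (1/2) *\<^sub>R y = (1/2) *s (x + y)" for x y :: "complex^'n"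
        unfolding vec_eq_iff vector_add_component vector_scaleR_component vector_smult_component
        by (simp add: scaleR_conv_of_real algebra_simps)
      ultimately show ?thesis by (simp only: m_def)
    qed
    have "(\<lambda>z. m z $ k) holomorphic_on X" for k
      unfolding m_def vector_smult_component vector_add_component
      by (intro holomorphic_intros holomorphic_n_comp_curve[OF f X(1)] holomorphic_on_quasi_disc)
         (auto simp: X_def)
    from holomorphic_n_comp_curve[OF g X(1) this mG]
    have hol: "(\<lambda>z. \<psi> z $ k) holomorphic_on X" for k by (simp add: \<psi>_def)
    have lim: "((\<lambda>z. ((1 / z^2) *s (\<psi> z - (z * ((s + t) / 2)) *s axis j 1)) $ k)
        \<longlongrightarrow> ((1/2) *s (axis i w + axis i w') + ((s - t)^2 / 4) *s b) $ k) (at 0)" for k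
      unfolding \<psi>_def m_def quasi_disc_def by (rule tendsto_vec_nth[OF b])
    have V: "((\<lambda>z. \<psi> z $ i / z^2) \<longlongrightarrow> (w + w') / 2 + (s - t)^2 / 4 * (b $ i)) (at 0)"
      using lim[of i] ij by (simp add: axis_def add_divide_distrib)
    \<comment> \<open>The first-order limit of the \<open>j\<close>-component is recovered from the
      second-order one: multiply the convergent quotient by \<open>z\<close> and add back
      \<open>(s + t) / 2\<close>.\<close>
    have "((\<lambda>z. z * (((1 / z^2) *s (\<psi> z - (z * ((s + t) / 2)) *s axis j 1)) $ j) + (s + t) / 2)
        \<longlongrightarrow> 0 * (((1/2) *s (axis i w + axis i w') + ((s - t)^2 / 4) *s b) $ j) + (s + t) / 2) (at 0)"
      by (intro tendsto_intros lim)
    then have "((\<lambda>z. z * (((1 / z^2) *s (\<psi> z - (z * ((s + t) / 2)) *s axis j 1)) $ j) + (s + t) / 2)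
        \<longlongrightarrow> (s + t) / 2) (at 0)" by simp
    moreover have "\<forall>\<^sub>F z in at 0. z * (((1 / z^2) *s (\<psi> z - (z * ((s + t) / 2)) *s axis j 1)) $ j) + (s + t) / 2
        = \<psi> z $ j / z"
    proof -
      have *: "z * ((x - z * T) / z^2) + T = x / z" if "z \<noteq> 0" for z x T :: complex
        using that by (simp add: power2_eq_square field_simps)
      have "((1 / z^2) *s (x - (z * T) *s axis j 1)) $ j = (x $ j - z * T) / z^2" for z T and x :: "complex^'n"
        by (simp add: diff_divide_distrib)
      then show ?thesis unfolding eventually_at_filter
        by (intro always_eventually allI impI) (simp only: * not_False_eq_True)
    qed
    ultimately have U: "((\<lambda>z. \<psi> z $ j / z) \<longlongrightarrow> (s + t) / 2) (at 0)"
      by (rule Lim_transform_eventually)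
    have sphere: "cmod (\<psi> z $ j / z) < 1 \<and>
        cmod (\<psi> z $ i / z^2 + (\<psi> z $ j / z)^2 - \<psi> z $ j / z) \<le> cmod (1 - \<psi> z $ j / z)" if z: "cmod z = 1" for z
    proof -
      have "\<psi> z \<in> D" unfolding \<psi>_def using z X(2) by (intro gG mG) auto
      then obtain x where x: "x \<in> lie_ball" "\<psi> z = Lambda_map i x" using D(3) by blast
      \<comment> \<open>For \<open>cmod z = 1\<close> the inverse dilation has modulus 1 and
        preserves the Lie ball; through \<open>Lambda_map\<close> it divides the
        \<open>i\<close>-component by \<open>z^2\<close> and the \<open>j\<close>-component by
        \<open>z\<close>.\<close>
      have "(1 / z) *s x \<in> lie_ball" using lie_ball_balanced[OF x(1), of "1 / z"] z by (simp add: norm_divide)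
      then have "Lambda_map i ((1 / z) *s x) \<in> Lambda_map i ` lie_ball" by blast
      from Lambda_lie_ball_bounds[OF this ij] show ?thesis
        using ij by (simp add: Lambda_map_smult x(2) power_divide)
    qed
    show ?thesis
      by (rule maximum_modulus_quotient[OF X hol hol U V]) (use sphere in auto)
  qed
  then show ?thesis by (intro exI[of _ "b $ i"]) blast
qed

text \<open>Taking real parts, the first hypothesis gives \<open>Re b \<ge> 41/81\<close> and the
  second \<open>Re b \<le> 196/729\<close>, which is smaller. The signs differ because
  \<open>(s - t)^2\<close> is positive for the first pair and negative for the conjugate pair. The
  unsimplified terms are literal instances of \<open>convex_model_inequality\<close>.\<close>

lemma no_common_shift:
  fixes b :: complex
  assumes 1: "cmod ((0 + (\<i> * (9/10))^2) / 2 + (9/10 - 0)^2 / 4 * b + ((9/10 + 0) / 2)^2 - (9/10 + 0) / 2)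
                \<le> cmod (1 - (9/10 + 0) / 2)"
    and 2: "cmod ((0 + 0) / 2 + (Complex (18/25) (27/50) - Complex (18/25) (- 27/50))^2 / 4 * b
                  + ((Complex (18/25) (27/50) + Complex (18/25) (- 27/50)) / 2)^2
                  - (Complex (18/25) (27/50) + Complex (18/25) (- 27/50)) / 2)
                \<le> cmod (1 - (Complex (18/25) (27/50) + Complex (18/25) (- 27/50)) / 2)"
  shows False
proof -
  have "(0 + (\<i> * (9/10))^2) / 2 + (9/10 - 0)^2 / 4 * b + ((9/10 + 0) / 2)^2 - (9/10 + 0) / 2
      = Complex (- 261/400 + 81/400 * Re b) (81/400 * Im b)"
    by (simp add: complex_eq_iff power2_eq_square)
  moreover have "1 - (9/10 + 0) / 2 = complex_of_real (11/20)" by simp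
  ultimately have "cmod (Complex (- 261/400 + 81/400 * Re b) (81/400 * Im b)) \<le> 11/20"
    using 1 by (simp only: norm_of_real; simp)
  then have A: "261/400 - 81/400 * Re b \<le> 11/20"
    using abs_Re_le_cmod[of "Complex (- 261/400 + 81/400 * Re b) (81/400 * Im b)"] by simp
  have "(0 + 0) / 2 + (Complex (18/25) (27/50) - Complex (18/25) (- 27/50))^2 / 4 * b
                  + ((Complex (18/25) (27/50) + Complex (18/25) (- 27/50)) / 2)^2
                  - (Complex (18/25) (27/50) + Complex (18/25) (- 27/50)) / 2
      = Complex (- 126/625 - 729/2500 * Re b) (- 729/2500 * Im b)"
    by (simp add: complex_eq_iff power2_eq_square)
  moreover have "1 - (Complex (18/25) (27/50) + Complex (18/25) (- 27/50)) / 2 = complex_of_real (7/25)"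
    by (simp add: complex_eq_iff)
  ultimately have "cmod (Complex (- 126/625 - 729/2500 * Re b) (- 729/2500 * Im b)) \<le> 7/25"
    using 2 by (simp only: norm_of_real; simp)
  then have "126/625 + 729/2500 * Re b \<le> 7/25"
    using abs_Re_le_cmod[of "Complex (- 126/625 - 729/2500 * Re b) (- 729/2500 * Im b)"] by simp
  then show False using A by linarith
qed

section \<open>Exhaustion and contradiction\<close>

lemma compact_subset_increasing_Union:
  fixes D :: "nat \<Rightarrow> 'a::topological_space set"
  assumes "compact K" "\<And>k. open (D k)" "\<And>k. D k \<subseteq> D (Suc k)" "K \<subseteq> (\<Union>k. D k)"
  shows "\<exists>k. K \<subseteq> D k"
proof -
  obtain I where I: "finite I" "K \<subseteq> (\<Union>k\<in>I. D k)"
    using compactE_image[OF assms(1), of UNIV D] assms(2,4) by auto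
  have "D k \<subseteq> D (Max (insert 0 I))" if "k \<in> I" for k
    using lift_Suc_mono_le[of D, OF assms(3)] that I(1) by simp
  then show ?thesis using I(2) by blast
qed

theorem theorem4p2:
  fixes i0 :: "'n::finite"
  assumes "CARD('n) \<ge> 2"
  shows "\<not> (\<exists>D :: nat \<Rightarrow> (complex^'n) set.
            (\<forall>k. D k \<subseteq> D (Suc k)) \<and>
            (\<Union>k. D k) = Lambda_map i0 ` lie_ball \<and>
            (\<forall>k. is_domain (D k) \<and>
                 (\<exists>G. is_domain G \<and> convex G \<and> biholomorphic (D k) G)))"
proof safe
  fix D :: "nat \<Rightarrow> (complex^'n) set"
  assume mono: "\<forall>k. D k \<subseteq> D (Suc k)" and UD: "(\<Union>k. D k) = Lambda_map i0 ` lie_ball"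
    and dom: "\<forall>k. is_domain (D k) \<and> (\<exists>G. is_domain G \<and> convex G \<and> biholomorphic (D k) G)"
  have "\<exists>j. i0 \<noteq> j"
  proof (rule ccontr)
    assume "\<nexists>j. i0 \<noteq> j"
    then have "(UNIV :: 'n set) = {i0}" by auto
    from arg_cong[OF this, of card] show False using assms by simp
  qed
  then obtain j where j: "i0 \<noteq> j" ..
  \<comment> \<open>\<open>p\<close> and \<open>q\<close> are 9/10 times
    \<open>(4 + 3 * \<i>) / 5\<close> and its conjugate, and \<open>w^2 = - 81/100\<close>. All
    moduli are 9/10, so the axis points lie in the Lie ball.\<close>
  define p where "p = Complex (18/25) (27/50)"
  define q where "q = Complex (18/25) (- 27/50)"
  define w where "w = \<i> * (9/10)"
  have norms: "cmod p < 1" "cmod q < 1" "cmod w < 1"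
    by (simp_all add: p_def q_def w_def norm_mult cmod_def power2_eq_square)
  have disc_t: "quasi_disc i0 j 0 t ` cball 0 1 \<subseteq> Lambda_map i0 ` lie_ball" if "cmod t < 1" for t
    using quasi_disc_Lambda_axis(1)[OF j] lie_ball_balanced[OF axis_in_lie_ball[OF that]]
    by (auto intro!: imageI)
  have disc_w: "quasi_disc i0 j (v^2) 0 ` cball 0 1 \<subseteq> Lambda_map i0 ` lie_ball" if "cmod v < 1" for v
    using quasi_disc_Lambda_axis(2)[OF j] lie_ball_balanced[OF axis_in_lie_ball[OF that]]
    by (auto intro!: imageI)
  \<comment> \<open>The four closed discs form one compact set, so a single \<open>D k\<close>
    contains them all; both inequalities then concern the same biholomorphism and the same
    \<open>b\<close>.\<close>
  define K where "K = quasi_disc i0 j 0 (9/10) ` cball 0 1 \<union> quasi_disc i0 j (w^2) 0 ` cball 0 1 \<union>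
      (quasi_disc i0 j 0 p ` cball 0 1 \<union> quasi_disc i0 j 0 q ` cball 0 1)"
  have "compact K"
    unfolding K_def by (intro compact_Un compact_continuous_image continuous_on_quasi_disc compact_cball)
  moreover have "K \<subseteq> (\<Union>k. D k)"
    unfolding K_def UD using disc_t[of "9/10"] disc_t[OF norms(1)] disc_t[OF norms(2)] disc_w[OF norms(3)] by simp
  ultimately obtain k where k: "K \<subseteq> D k"
    using compact_subset_increasing_Union[of K D] mono dom unfolding is_domain_def by blast
  obtain G where G: "is_domain G" "convex G" "biholomorphic (D k) G" using dom by blast
  \<comment> \<open>Every quasi-disc passes through the origin at parameter 0, which supplies the
    base point of the expansion in \<open>D k\<close>.\<close>
  have "quasi_disc i0 j 0 p 0 = 0" by (simp add: quasi_disc_def)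
  then have "0 \<in> K" unfolding K_def by (force simp: image_iff)
  then have "0 \<in> D k" using k by blast
  moreover have "open (D k)" "open G" using dom G(1) by (auto simp: is_domain_def)
  moreover have "D k \<subseteq> Lambda_map i0 ` lie_ball" using UD by blast
  ultimately obtain b where b: "\<And>w s w' t. quasi_disc i0 j w s ` cball 0 1 \<subseteq> D k \<Longrightarrow>
      quasi_disc i0 j w' t ` cball 0 1 \<subseteq> D k \<Longrightarrow>
      cmod ((w + w') / 2 + (s - t)^2 / 4 * b + ((s + t) / 2)^2 - (s + t) / 2) \<le> cmod (1 - (s + t) / 2)"
    using convex_model_inequality[OF _ _ _ j _ G(2,3)] by blast
  show False
    using no_common_shift[of b] b[of 0 "9/10" "w^2" 0] b[of 0 p 0 q] k
    unfolding K_def p_def q_def w_def by blast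
qed

end
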